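(* Let $X$ be a set. The monoids $$\mathcal{P}^{\mathrm{fd}}_X=\{\alpha\in\mathcal{P}_X:\mathrm{dom}(\alpha)=X\}\quad\text{and}\quad \mathcal{P}^{\mathrm{fcd}}_X=\{\alpha\in\mathcal{P}_X:\mathrm{codom}(\alpha)=X\}$$ of all full-domain and full-codomain partitions are right- and left-restriction monoids, respectively, with respect to the semilattice $F=E(\mathcal{J}_X)$ coming from the dual symmetric inverse monoid over $X$. Further, $\mathcal{P}^{\mathrm{fd}}_X\cap\mathcal{P}^{\mathrm{fcd}}_X=\mathcal{J}_X$.
   Context: Partition monoid: let $X$ be a set and $X'=\{x':x\in X\}$ a disjoint copy of $X$. $\mathcal{P}_X$ is the set of all set partitions of $X\cup X'$. Given $\alpha,\beta\in\mathcal{P}_X$, let $X''=\{x'':x\in X\}$ be another disjoint copy; represent $\alpha$ and $\beta$ by graphs on $X\cup X'$ whose connected components are the blocks; rename each lower vertex $x'$ of $\alpha$ to $x''$ and each upper vertex $x$ of $\beta$ to $x''$; take the union of these graphs on $X\cup X''\cup X'$. The product $\alpha\beta$ is the partition of $X\cup X'$ in which two elements lie in the same block iff they are joined by a path in this union graph. This makes $\mathcal{P}_X$ a monoid. A block is a transversal if it meets both $X$ and $X'$. $\mathrm{dom}(\alpha)$ (resp. $\mathrm{codom}(\alpha)$) is the set of $x\in X$ such that $x$ (resp. $x'$) belongs to a transversal of $\alpha$. The dual symmetric inverse monoid is $\mathcal{J}_X=\{\alpha\in\mathcal{P}_X:\mathrm{dom}(\alpha)=\mathrm{codom}(\alpha)=X\}$.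 For an equivalence $\varepsilon$ on $X$, $\mathrm{id}_\varepsilon=\{A\cup A':A\in X/\varepsilon\}$; $F=E(\mathcal{J}_X)=\{\mathrm{id}_\varepsilon:\varepsilon\text{ an equivalence on }X\}$ is the semilattice of idempotents of $\mathcal{J}_X$. Ehresmann and restriction semigroups: let $S$ be a semigroup and $E\subseteq S$ a semilattice (a commutative subsemigroup consisting of idempotents). For $x\in S$ let $E_L(x)=\{e\in E:x=ex\}$ and $E_R(x)=\{e\in E:x=xe\}$. Define $x\,\mathscr{R}^E\,y\iff E_L(x)=E_L(y)$ and $x\,\mathscr{L}^E\,y\iff E_R(x)=E_R(y)$. $S$ is left $E$-Ehresmann if every $\mathscr{R}^E$-class contains precisely one element of $E$ and $\mathscr{R}^E$ is a left congruence ($x\,\mathscr{R}^E\,y\Rightarrow ax\,\mathscr{R}^E\,ay$). $S$ is right $E$-Ehresmann if every $\mathscr{L}^E$-class contains precisely one element of $E$ and $\mathscr{L}^E$ is a right congruence ($x\,\mathscr{L}^E\,y\Rightarrow xa\,\mathscr{L}^E\,ya$). A left $E$-Ehresmann semigroup is left-restriction (with respect to $E$) if $xE\subseteq Ex$ for all $x\in S$; a right $E$-Ehresmann semigroup is right-restriction (with respect to $E$) if $Ex\subseteq xE$ for all $x\in S$. *)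

theory Defs
  imports "HOL-Algebra.Coset" "HOL-Library.Disjoint_Sets"
begin

section \<open>Ehresmann and restriction semigroups\<close>

text \<open>
  Semigroups are carried by the monoid records of HOL-Algebra; the \<open>one\<close> field plays no role
  in this section.
\<close>

definition is_semigroup :: "('a, 'm) monoid_scheme \<Rightarrow> bool" where
  "is_semigroup S \<longleftrightarrow>
     (\<forall>x\<in>carrier S. \<forall>y\<in>carrier S. x \<otimes>\<^bsub>S\<^esub> y \<in> carrier S) \<and>
     (\<forall>x\<in>carrier S. \<forall>y\<in>carrier S. \<forall>z\<in>carrier S.
        (x \<otimes>\<^bsub>S\<^esub> y) \<otimes>\<^bsub>S\<^esub> z = x \<otimes>\<^bsub>S\<^esub> (y \<otimes>\<^bsub>S\<^esub> z))"

definition idempotents :: "('a, 'm) monoid_scheme \<Rightarrow> 'a set" where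
  "idempotents S = {e \<in> carrier S. e \<otimes>\<^bsub>S\<^esub> e = e}"

definition subsemilattice :: "'a set \<Rightarrow> ('a, 'm) monoid_scheme \<Rightarrow> bool" where
  "subsemilattice E S \<longleftrightarrow>
     E \<subseteq> idempotents S \<and>
     (\<forall>e\<in>E. \<forall>f\<in>E. e \<otimes>\<^bsub>S\<^esub> f \<in> E) \<and>
     (\<forall>e\<in>E. \<forall>f\<in>E. e \<otimes>\<^bsub>S\<^esub> f = f \<otimes>\<^bsub>S\<^esub> e)"

definition left_ids :: "('a, 'm) monoid_scheme \<Rightarrow> 'a set \<Rightarrow> 'a \<Rightarrow> 'a set" where
  "left_ids S E x = {e \<in> E. x = e \<otimes>\<^bsub>S\<^esub> x}"

definition right_ids :: "('a, 'm) monoid_scheme \<Rightarrow> 'a set \<Rightarrow> 'a \<Rightarrow> 'a set" where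
  "right_ids S E x = {e \<in> E. x = x \<otimes>\<^bsub>S\<^esub> e}"

definition R_rel :: "('a, 'm) monoid_scheme \<Rightarrow> 'a set \<Rightarrow> ('a \<times> 'a) set" where
  "R_rel S E = {(x, y) \<in> carrier S \<times> carrier S. left_ids S E x = left_ids S E y}"

definition L_rel :: "('a, 'm) monoid_scheme \<Rightarrow> 'a set \<Rightarrow> ('a \<times> 'a) set" where
  "L_rel S E = {(x, y) \<in> carrier S \<times> carrier S. right_ids S E x = right_ids S E y}"

definition left_Ehresmann :: "('a, 'm) monoid_scheme \<Rightarrow> 'a set \<Rightarrow> bool" where
  "left_Ehresmann S E \<longleftrightarrow>
     is_semigroup S \<and> subsemilattice E S \<and>
     (\<forall>C \<in> carrier S // R_rel S E. \<exists>!e. e \<in> C \<inter> E) \<and>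
     (\<forall>a\<in>carrier S. \<forall>(x, y) \<in> R_rel S E. (a \<otimes>\<^bsub>S\<^esub> x, a \<otimes>\<^bsub>S\<^esub> y) \<in> R_rel S E)"

definition right_Ehresmann :: "('a, 'm) monoid_scheme \<Rightarrow> 'a set \<Rightarrow> bool" where
  "right_Ehresmann S E \<longleftrightarrow>
     is_semigroup S \<and> subsemilattice E S \<and>
     (\<forall>C \<in> carrier S // L_rel S E. \<exists>!e. e \<in> C \<inter> E) \<and>
     (\<forall>a\<in>carrier S. \<forall>(x, y) \<in> L_rel S E. (x \<otimes>\<^bsub>S\<^esub> a, y \<otimes>\<^bsub>S\<^esub> a) \<in> L_rel S E)"

text \<open>Below, \<open>x <# E\<close> is the set \<open>xE\<close> and \<open>E #> x\<close> is the set \<open>Ex\<close>.\<close>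

definition left_restriction :: "('a, 'm) monoid_scheme \<Rightarrow> 'a set \<Rightarrow> bool" where
  "left_restriction S E \<longleftrightarrow>
     left_Ehresmann S E \<and> (\<forall>x\<in>carrier S. x <#\<^bsub>S\<^esub> E \<subseteq> E #>\<^bsub>S\<^esub> x)"

definition right_restriction :: "('a, 'm) monoid_scheme \<Rightarrow> 'a set \<Rightarrow> bool" where
  "right_restriction S E \<longleftrightarrow>
     right_Ehresmann S E \<and> (\<forall>x\<in>carrier S. E #>\<^bsub>S\<^esub> x \<subseteq> x <#\<^bsub>S\<^esub> E)"


section \<open>Partition monoids\<close>

text \<open>
  The set \<open>X \<union> X'\<close> is the disjoint sum \<open>X <+> X\<close>: \<open>Inl x\<close> is the upper vertex \<open>x\<close> and \<open>Inr x\<close> is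
  the lower vertex \<open>x'\<close>.  Since \<open>partition_on\<close> demands nonempty blocks, \<open>X = {}\<close> gives the
  one-element monoid consisting of the empty partition.
\<close>

type_synonym 'a diagram = "('a + 'a) set set"

datatype 'a vertex = Upper 'a | Middle 'a | Lower 'a

text \<open>
  A partition is represented by the graph that is complete (with loops) on each block, as a
  symmetric set of edges; any graph with the same connected components yields the same product.
\<close>

definition block_graph :: "'a diagram \<Rightarrow> (('a + 'a) \<times> ('a + 'a)) set" where
  "block_graph \<alpha> = (\<Union>A\<in>\<alpha>. A \<times> A)"

definition product_graph :: "'a diagram \<Rightarrow> 'a diagram \<Rightarrow> ('a vertex \<times> 'a vertex) set" where
  "product_graph \<alpha> \<beta> =
     map_prod (case_sum Upper Middle) (case_sum Upper Middle) ` block_graph \<alpha> \<union>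
     map_prod (case_sum Middle Lower) (case_sum Middle Lower) ` block_graph \<beta>"

definition joined :: "'a set \<Rightarrow> 'a diagram \<Rightarrow> 'a diagram \<Rightarrow> (('a + 'a) \<times> ('a + 'a)) set" where
  "joined X \<alpha> \<beta> = {(u, v) \<in> (X <+> X) \<times> (X <+> X).
     (case_sum Upper Lower u, case_sum Upper Lower v) \<in> (product_graph \<alpha> \<beta>)\<^sup>*}"

definition diagram_mult :: "'a set \<Rightarrow> 'a diagram \<Rightarrow> 'a diagram \<Rightarrow> 'a diagram" where
  "diagram_mult X \<alpha> \<beta> = (X <+> X) // joined X \<alpha> \<beta>"

definition partition_monoid :: "'a set \<Rightarrow> 'a diagram monoid" where
  "partition_monoid X =
     \<lparr>carrier = {\<alpha>. partition_on (X <+> X) \<alpha>},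
      mult = diagram_mult X,
      one = (\<lambda>x. {Inl x, Inr x}) ` X\<rparr>"

definition transversal :: "('a + 'a) set \<Rightarrow> bool" where
  "transversal A \<longleftrightarrow> A \<inter> range Inl \<noteq> {} \<and> A \<inter> range Inr \<noteq> {}"

definition diagram_dom :: "'a set \<Rightarrow> 'a diagram \<Rightarrow> 'a set" where
  "diagram_dom X \<alpha> = {x \<in> X. \<exists>A\<in>\<alpha>. transversal A \<and> Inl x \<in> A}"

definition diagram_codom :: "'a set \<Rightarrow> 'a diagram \<Rightarrow> 'a set" where
  "diagram_codom X \<alpha> = {x \<in> X. \<exists>A\<in>\<alpha>. transversal A \<and> Inr x \<in> A}"

definition full_domain_monoid :: "'a set \<Rightarrow> 'a diagram monoid" where
  "full_domain_monoid X = (partition_monoid X)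
     \<lparr>carrier := {\<alpha> \<in> carrier (partition_monoid X). diagram_dom X \<alpha> = X}\<rparr>"

definition full_codomain_monoid :: "'a set \<Rightarrow> 'a diagram monoid" where
  "full_codomain_monoid X = (partition_monoid X)
     \<lparr>carrier := {\<alpha> \<in> carrier (partition_monoid X). diagram_codom X \<alpha> = X}\<rparr>"

definition dual_symmetric_inverse_monoid :: "'a set \<Rightarrow> 'a diagram monoid" where
  "dual_symmetric_inverse_monoid X = (partition_monoid X)
     \<lparr>carrier := {\<alpha> \<in> carrier (partition_monoid X).
        diagram_dom X \<alpha> = X \<and> diagram_codom X \<alpha> = X}\<rparr>"

end

theory Submission
  imports Defs
begin

text \<open>
  The proof represents diagrams faithfully by binary relations on the powerset of \<open>X\<close>.  A diagram
  \<open>\<alpha>\<close> is sent to the relation \<open>saturation X \<alpha>\<close> of all pairs \<open>(P, Q)\<close> of subsets of \<open>X\<close> such that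
  the vertex set consisting of \<open>P\<close> in the upper row and \<open>Q\<close> in the lower row is a union of blocks.
  The blocks can be recovered from these unions, so the map is injective (\<open>saturation_inj\<close>).  It
  turns the product of diagrams into composition of relations (\<open>saturation_mult\<close>): a union of
  components of the product graph restricts to a set of middle vertices compatible with both
  factors, and compatible pieces glue together.

  Under this representation everything becomes elementary relation algebra.  Associativity is that
  of relational composition.  A diagram has full domain exactly when \<open>P\<close> is determined by \<open>Q\<close>, and
  full codomain exactly when \<open>Q\<close> is determined by \<open>P\<close>
  (\<open>full_dom_iff_single_valued\<close>, \<open>full_codom_iff_single_valued\<close>); both properties are visibly closed
  under composition.  Elements of the dual symmetric inverse monoid become partial injections, and
  an idempotent partial injection is a partial identity, so that \<open>F\<close> is the set of all diagrams
  represented by subrelations of the identity (\<open>idempotents_dual_symmetric_inverse_monoid\<close>).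

  For \<open>\<alpha>\<close> in the full-domain monoid, the element of \<open>F\<close> in its \<open>L\<close>-class is the one represented by
  the identity on the range of the relation of \<open>\<alpha>\<close>.  It is the diagram \<open>id\<close> of the equivalence that
  \<open>\<alpha>\<close> induces on the lower row, because the range consists of the sets saturated for that
  equivalence (\<open>ex_projection_Range\<close>).  The axioms of a right-restriction semigroup then hold for any
  semigroup of relations with single-valued converses that contains these identities
  (\<open>right_restriction_if_relational_representation\<close>).  The statement for full codomains follows by
  reversing products, relations and diagrams.
\<close>

section \<open>Restriction semigroups of relations\<close>

definition opposite :: "('a, 'm) monoid_scheme \<Rightarrow> 'a monoid" where
  "opposite S = \<lparr>carrier = carrier S, mult = (\<lambda>x y. y \<otimes>\<^bsub>S\<^esub> x), one = \<one>\<^bsub>S\<^esub>\<rparr>"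

lemma opposite_sel [simp]:
  "carrier (opposite S) = carrier S"
  "x \<otimes>\<^bsub>opposite S\<^esub> y = y \<otimes>\<^bsub>S\<^esub> x"
  by (simp_all add: opposite_def)

lemma left_restriction_if_opposite_right_restriction:
  assumes "right_restriction (opposite S) E"
  shows "left_restriction S E"
proof -
  have "is_semigroup S" if "is_semigroup (opposite S)"
    using that by (simp add: is_semigroup_def)
  moreover have "subsemilattice E S" if "subsemilattice E (opposite S)"
    using that by (auto simp: subsemilattice_def idempotents_def)
  moreover have "L_rel (opposite S) E = R_rel S E"
    by (simp add: L_rel_def R_rel_def left_ids_def right_ids_def)
  ultimately show ?thesis
    using assms
    by (simp add: right_restriction_def left_restriction_def right_Ehresmann_def
        left_Ehresmann_def l_coset_def r_coset_def)
qed

text \<open>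
  Write \<open>x\<^sup>*\<close> for the element represented by the identity on the range of \<open>M x\<close>.  For \<open>e\<close> below the
  identity, \<open>x e = x\<close> says precisely that \<open>M e\<close> contains the identity on the range of \<open>M x\<close>.  Hence
  the \<open>L\<close>-class of \<open>x\<close> is determined by the range of \<open>M x\<close> and contains \<open>x\<^sup>*\<close>.  The range of
  \<open>M x O M a\<close> depends only on \<open>a\<close> and the range of \<open>M x\<close>, which makes \<open>L\<close> a right congruence.
  If \<open>P\<close> is determined by \<open>Q\<close> whenever \<open>(P, Q) \<in> M x\<close>, then restricting \<open>M x\<close> on the left amounts to
  restricting it on the right to the values attained, that is, \<open>e x = x (e x)\<^sup>*\<close>.
\<close>

lemma right_restriction_if_relational_representation:
  fixes S :: "('a, 'm) monoid_scheme" and M :: "'a \<Rightarrow> ('b \<times> 'b) set"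
  assumes closed: "\<And>x y. x \<in> carrier S \<Longrightarrow> y \<in> carrier S \<Longrightarrow> x \<otimes>\<^bsub>S\<^esub> y \<in> carrier S"
    and inj: "inj_on M (carrier S)"
    and hom: "\<And>x y. x \<in> carrier S \<Longrightarrow> y \<in> carrier S \<Longrightarrow> M (x \<otimes>\<^bsub>S\<^esub> y) = M x O M y"
    and sv: "\<And>x. x \<in> carrier S \<Longrightarrow> single_valued ((M x)\<inverse>)"
    and ex: "\<And>x. x \<in> carrier S \<Longrightarrow> \<exists>e\<in>carrier S. M e = Id_on (Range (M x))"
  shows "right_restriction S {e \<in> carrier S. M e \<subseteq> Id}"
proof -
  define E where "E = {e \<in> carrier S. M e \<subseteq> Id}"
  have EI: "e \<in> E" if "e \<in> carrier S" "M e \<subseteq> Id" for e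
    using that by (simp add: E_def)
  have Ec: "e \<in> carrier S" and Es: "M e \<subseteq> Id" if "e \<in> E" for e
    using that by (auto simp: E_def)
  have eqI: "x = y" if "x \<in> carrier S" "y \<in> carrier S" "M x = M y" for x y
    using inj that by (auto dest: inj_onD)
  obtain s where sc: "\<And>x. x \<in> carrier S \<Longrightarrow> s x \<in> carrier S"
    and Ms: "\<And>x. x \<in> carrier S \<Longrightarrow> M (s x) = Id_on (Range (M x))"
    using bchoice[of "carrier S" "\<lambda>x e. e \<in> carrier S \<and> M e = Id_on (Range (M x))"] ex
    by blast
  have sE: "s x \<in> E" if "x \<in> carrier S" for x
    using sc[OF that] Ms[OF that] by (auto intro!: EI)
  have semigroup: "is_semigroup S"
    unfolding is_semigroup_def
    by (auto intro!: closed eqI simp: hom closed O_assoc)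
  have commute: "e \<otimes>\<^bsub>S\<^esub> f = f \<otimes>\<^bsub>S\<^esub> e" if "e \<in> E" "f \<in> E" for e f
    using Es[OF that(1)] Es[OF that(2)] that
    by (intro eqI) (auto simp: hom closed Ec)
  have idem: "e \<otimes>\<^bsub>S\<^esub> e = e" if "e \<in> E" for e
    using Es[OF that] that by (intro eqI) (auto simp: hom closed Ec)
  have E_closed: "e \<otimes>\<^bsub>S\<^esub> f \<in> E" if "e \<in> E" "f \<in> E" for e f
    using Es[OF that(1)] Es[OF that(2)] that by (intro EI) (auto simp: hom closed Ec)
  have lattice: "subsemilattice E S"
    unfolding subsemilattice_def idempotents_def
    using commute idem E_closed Ec by auto
  have right_ids_iff: "x = x \<otimes>\<^bsub>S\<^esub> e \<longleftrightarrow> Id_on (Range (M x)) \<subseteq> M e"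
    if "x \<in> carrier S" "e \<in> E" for x e
  proof -
    have "x = x \<otimes>\<^bsub>S\<^esub> e \<longleftrightarrow> M x = M x O M e"
      using that by (metis Ec closed eqI hom)
    also have "\<dots> \<longleftrightarrow> Id_on (Range (M x)) \<subseteq> M e"
      using Es[OF that(2)] by (auto 0 4 simp: set_eq_iff subset_iff)
    finally show ?thesis .
  qed
  have right_ids_s: "right_ids S E (s x) = right_ids S E x" if "x \<in> carrier S" for x
  proof -
    have "Range (M (s x)) = Range (M x)"
      using Ms[OF that] by auto
    then show ?thesis
      unfolding right_ids_def using right_ids_iff that sc by auto
  qed
  \<comment> \<open>Two elements of a semilattice with the same right identities absorb each other, and
    they commute.\<close>
  have E_eqI: "e = f" if "e \<in> E" "f \<in> E" "right_ids S E e = right_ids S E f" for e f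
  proof -
    have "e = e \<otimes>\<^bsub>S\<^esub> f" "f = f \<otimes>\<^bsub>S\<^esub> e"
      using that idem unfolding right_ids_def by auto
    then show ?thesis using commute that by metis
  qed
  have unique: "\<exists>!e. e \<in> C \<inter> E" if "C \<in> carrier S // L_rel S E" for C
  proof -
    obtain x where x: "x \<in> carrier S" "C = L_rel S E `` {x}"
      using \<open>C \<in> _\<close> by (auto elim: quotientE)
    then have C: "y \<in> C \<longleftrightarrow> y \<in> carrier S \<and> right_ids S E y = right_ids S E x" for y
      by (auto simp: L_rel_def)
    show ?thesis
      using x(1) C sc sE right_ids_s E_eqI by (intro ex1I[of _ "s x"]) auto
  qed
  have congruence: "(x \<otimes>\<^bsub>S\<^esub> a, y \<otimes>\<^bsub>S\<^esub> a) \<in> L_rel S E"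
    if a: "a \<in> carrier S" and xy: "(x, y) \<in> L_rel S E" for a x y
  proof -
    have c: "x \<in> carrier S" "y \<in> carrier S" "right_ids S E x = right_ids S E y"
      using xy by (auto simp: L_rel_def)
    then have "s x = s y"
      using right_ids_s sE by (intro E_eqI) auto
    then have "Range (M x) = Range (M y)"
      using Ms[OF c(1)] Ms[OF c(2)] by (metis Range_Id_on)
    then have "Range (M (x \<otimes>\<^bsub>S\<^esub> a)) = Range (M (y \<otimes>\<^bsub>S\<^esub> a))"
      using a c by (simp add: hom) blast
    then show ?thesis
      using a c right_ids_iff closed by (auto simp: L_rel_def right_ids_def)
  qed
  have restriction: "e \<otimes>\<^bsub>S\<^esub> x = x \<otimes>\<^bsub>S\<^esub> s (e \<otimes>\<^bsub>S\<^esub> x)"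
    if "e \<in> E" "x \<in> carrier S" for e x
  proof (rule eqI)
    \<comment> \<open>A value in the range of \<open>M e O M x\<close> has only one preimage under \<open>M x\<close>, and that one lies in the
      domain of \<open>M e\<close>.\<close>
    have "M e O M x = M x O Id_on (Range (M e O M x))"
      using Es[OF that(1)] sv[OF that(2)] unfolding single_valued_def by blast
    then show "M (e \<otimes>\<^bsub>S\<^esub> x) = M (x \<otimes>\<^bsub>S\<^esub> s (e \<otimes>\<^bsub>S\<^esub> x))"
      using that by (simp add: hom closed Ec sc Ms)
  qed (use that in \<open>simp_all add: closed Ec sc\<close>)
  have cosets: "E #>\<^bsub>S\<^esub> x \<subseteq> x <#\<^bsub>S\<^esub> E" if "x \<in> carrier S" for x
  proof
    fix y assume "y \<in> E #>\<^bsub>S\<^esub> x"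
    then obtain e where "e \<in> E" "y = e \<otimes>\<^bsub>S\<^esub> x"
      by (auto simp: r_coset_def)
    then show "y \<in> x <#\<^bsub>S\<^esub> E"
      using restriction[of e x] sE[of "e \<otimes>\<^bsub>S\<^esub> x"] closed Ec that
      by (auto simp: l_coset_def)
  qed
  have "right_Ehresmann S E"
    unfolding right_Ehresmann_def
  proof (intro conjI ballI)
    show "case xy of (x, y) \<Rightarrow> (x \<otimes>\<^bsub>S\<^esub> a, y \<otimes>\<^bsub>S\<^esub> a) \<in> L_rel S E"
      if "a \<in> carrier S" "xy \<in> L_rel S E" for a xy
      using that congruence by (cases xy) simp
  qed (fact semigroup lattice unique)+
  then have "right_restriction S E"
    using cosets by (simp add: right_restriction_def)
  then show ?thesis by (simp add: E_def)
qed

corollary left_restriction_if_relational_representation: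
  fixes S :: "('a, 'm) monoid_scheme" and M :: "'a \<Rightarrow> ('b \<times> 'b) set"
  assumes "\<And>x y. x \<in> carrier S \<Longrightarrow> y \<in> carrier S \<Longrightarrow> x \<otimes>\<^bsub>S\<^esub> y \<in> carrier S"
    and inj: "inj_on M (carrier S)"
    and "\<And>x y. x \<in> carrier S \<Longrightarrow> y \<in> carrier S \<Longrightarrow> M (x \<otimes>\<^bsub>S\<^esub> y) = M x O M y"
    and "\<And>x. x \<in> carrier S \<Longrightarrow> single_valued (M x)"
    and ex: "\<And>x. x \<in> carrier S \<Longrightarrow> \<exists>e\<in>carrier S. M e = Id_on (Domain (M x))"
  shows "left_restriction S {e \<in> carrier S. M e \<subseteq> Id}"
proof -
  have "right_restriction (opposite S) {e \<in> carrier (opposite S). (M e)\<inverse> \<subseteq> Id}"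
  proof (rule right_restriction_if_relational_representation)
    show "inj_on (\<lambda>x. (M x)\<inverse>) (carrier (opposite S))"
      using inj by (simp add: inj_on_def)
    show "\<exists>e\<in>carrier (opposite S). (M e)\<inverse> = Id_on (Range ((M x)\<inverse>))"
      if "x \<in> carrier (opposite S)" for x
      using ex[of x] that by (metis Range_converse converse_Id_on opposite_sel(1))
  qed (use assms in \<open>simp_all add: converse_relcomp\<close>)
  moreover have "(M e)\<inverse> \<subseteq> Id \<longleftrightarrow> M e \<subseteq> Id" for e
    by auto
  ultimately show ?thesis
    by (simp add: left_restriction_if_opposite_right_restriction)
qed


section \<open>The saturation relation of a diagram\<close>

text \<open>
  The pairs in this relation are called compatible with \<open>\<alpha>\<close> below.
\<close>

definition saturation :: "'a set \<Rightarrow> 'a diagram \<Rightarrow> ('a set \<times> 'a set) set" where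
  "saturation X \<alpha> =
     {(P, Q). P \<subseteq> X \<and> Q \<subseteq> X \<and> (\<forall>A\<in>\<alpha>. A \<subseteq> P <+> Q \<or> A \<inter> (P <+> Q) = {})}"

lemma saturationI:
  assumes "P \<subseteq> X" "Q \<subseteq> X"
    and "\<And>A u v. A \<in> \<alpha> \<Longrightarrow> u \<in> A \<Longrightarrow> v \<in> A \<Longrightarrow> u \<in> P <+> Q \<Longrightarrow> v \<in> P <+> Q"
  shows "(P, Q) \<in> saturation X \<alpha>"
proof -
  have "A \<subseteq> P <+> Q" if "A \<in> \<alpha>" "u \<in> A" "u \<in> P <+> Q" for A u
    using assms(3)[OF that(1,2) _ that(3)] by (rule subsetI)
  then show ?thesis
    using assms(1,2) unfolding saturation_def disjoint_iff by simp metis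
qed

lemma saturation_block:
  assumes "(P, Q) \<in> saturation X \<alpha>" "A \<in> \<alpha>" "u \<in> A" "v \<in> A"
  shows "u \<in> P <+> Q \<longleftrightarrow> v \<in> P <+> Q"
  using assms by (auto simp: saturation_def)

lemma saturation_quotient:
  assumes "equiv (X <+> X) r"
  shows "(P, Q) \<in> saturation X ((X <+> X) // r) \<longleftrightarrow>
    P \<subseteq> X \<and> Q \<subseteq> X \<and> (\<forall>(u, v)\<in>r. u \<in> P <+> Q \<longrightarrow> v \<in> P <+> Q)"
    (is "_ \<longleftrightarrow> ?R")
proof
  assume L: "(P, Q) \<in> saturation X ((X <+> X) // r)"
  have "v \<in> P <+> Q" if "(u, v) \<in> r" "u \<in> P <+> Q" for u v
  proof -
    have "u \<in> X <+> X" using L that(2) by (auto simp: saturation_def)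
    then have "r `` {u} \<in> (X <+> X) // r" "u \<in> r `` {u}"
      by (rule quotientI, rule equiv_class_self[OF assms])
    then show ?thesis
      using saturation_block[OF L, of "r `` {u}" u v] that by auto
  qed
  then show ?R using L by (auto simp: saturation_def)
next
  assume R: ?R
  show "(P, Q) \<in> saturation X ((X <+> X) // r)"
  proof (rule saturationI)
    fix A u v
    assume A: "A \<in> (X <+> X) // r" "u \<in> A" "v \<in> A" and u: "u \<in> P <+> Q"
    then have "(u, v) \<in> r"
      using quotient_eq_iff[OF assms A(1) A(1) A(2,3)] by simp
    then show "v \<in> P <+> Q" using R u by fast
  qed (use R in auto)
qed

lemma Plus_vimage_eq [simp]: "(Inl -` A) <+> (Inr -` A) = A"
proof (rule Set.set_eqI)
  show "u \<in> (Inl -` A) <+> (Inr -` A) \<longleftrightarrow> u \<in> A" for u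
    by (cases u) auto
qed

text \<open>
  Single blocks are the least nonempty unions of blocks, so the saturation relation knows them;
  this is the source of the faithfulness of the representation.
\<close>

lemma block_in_saturation:
  assumes "partition_on (X <+> X) \<alpha>" "A \<in> \<alpha>"
  shows "(Inl -` A, Inr -` A) \<in> saturation X \<alpha>"
proof -
  have "A \<subseteq> X <+> X" using assms by (auto simp: partition_on_def)
  moreover have "B \<subseteq> A \<or> B \<inter> A = {}" if "B \<in> \<alpha>" for B
    using assms that by (auto simp: partition_on_def disjoint_def)
  moreover from calculation have "Inl -` A \<subseteq> X" "Inr -` A \<subseteq> X"
    by auto
  ultimately show ?thesis
    by (simp add: saturation_def)
qed

text \<open>
  If two partitions have the same unions of blocks, every block of one contains a block of the other
  through each of its points.  Going back and forth, this block contains a block of the first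
  partition through the same point, which must be the original one.
\<close>

lemma saturation_inj: "inj_on (saturation X) {\<alpha>. partition_on (X <+> X) \<alpha>}"
proof -
  have sub: "\<exists>B\<in>\<beta>. u \<in> B \<and> B \<subseteq> A"
    if "partition_on (X <+> X) \<alpha>" "partition_on (X <+> X) \<beta>"
      "saturation X \<alpha> = saturation X \<beta>" "A \<in> \<alpha>" "u \<in> A" for \<alpha> \<beta> A u
  proof -
    have "u \<in> \<Union>\<beta>"
      using partition_onD1[OF that(1)] partition_onD1[OF that(2)] that(4,5) by blast
    then obtain B where B: "B \<in> \<beta>" "u \<in> B"
      by blast
    have "v \<in> A" if "v \<in> B" for v
    proof -
      have "(Inl -` A, Inr -` A) \<in> saturation X \<beta>"
        using block_in_saturation[OF \<open>partition_on (X <+> X) \<alpha>\<close> \<open>A \<in> \<alpha>\<close>]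
          \<open>saturation X \<alpha> = saturation X \<beta>\<close> by simp
      from saturation_block[OF this B that] show ?thesis
        using \<open>u \<in> A\<close> by simp
    qed
    then show ?thesis using B by blast
  qed
  have "\<alpha> \<subseteq> \<beta>" if p: "partition_on (X <+> X) \<alpha>" "partition_on (X <+> X) \<beta>"
      "saturation X \<alpha> = saturation X \<beta>" for \<alpha> \<beta>
  proof
    fix A assume A: "A \<in> \<alpha>"
    then obtain u where u: "u \<in> A"
      using partition_onD3[OF p(1)] by (metis ex_in_conv)
    obtain B where B: "B \<in> \<beta>" "u \<in> B" "B \<subseteq> A"
      using sub[OF p A u] by blast
    obtain A' where "A' \<in> \<alpha>" "u \<in> A'" "A' \<subseteq> B"
      using sub[OF p(2,1) p(3)[symmetric] B(1,2)] by blast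
    moreover from this have "A' = A"
      using A u disjointD[OF partition_onD2[OF p(1)], of A A'] by blast
    ultimately show "A \<in> \<beta>" using B by auto
  qed
  then show ?thesis by (auto intro!: inj_onI)
qed


section \<open>Multiplication of diagrams\<close>

lemma equiv_joined: "equiv (X <+> X) (joined X \<alpha> \<beta>)"
proof -
  have "sym (block_graph \<gamma>)" for \<gamma> :: "'a diagram"
    by (auto simp: sym_def block_graph_def)
  then have "sym (product_graph \<alpha> \<beta>)"
    unfolding sym_def product_graph_def by fastforce
  then have "sym ((product_graph \<alpha> \<beta>)\<^sup>*)"
    by (rule sym_rtrancl)
  then show ?thesis
    unfolding joined_def
    by (intro equivI refl_onI symI transI) (auto dest: symD intro: rtrancl_trans)
qed

lemma partition_on_diagram_mult: "partition_on (X <+> X) (diagram_mult X \<alpha> \<beta>)"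
  unfolding diagram_mult_def by (rule partition_on_quotient[OF equiv_joined])

text \<open>
  A compatible pair \<open>(P, R)\<close> for \<open>\<alpha>\<close> and a compatible pair \<open>(R, Q)\<close> for \<open>\<beta>\<close> give a vertex set of the
  product graph that no edge leaves, hence no path either.  Conversely, given \<open>(P, Q)\<close> for the
  product, let \<open>R\<close> consist of the middle vertices reachable from \<open>P\<close> or \<open>Q\<close>.  Reachability returns to the
  outer rows only inside \<open>P\<close> and \<open>Q\<close>, because outer vertices joined by a path lie in one block of the
  product.
\<close>

lemma saturation_mult:
  assumes "partition_on (X <+> X) \<alpha>" "partition_on (X <+> X) \<beta>"
  shows "saturation X (diagram_mult X \<alpha> \<beta>) = saturation X \<alpha> O saturation X \<beta>"
proof (intro Set.set_eqI iffI)
  fix PQ assume "PQ \<in> saturation X \<alpha> O saturation X \<beta>"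
  then obtain P R Q where PQ: "PQ = (P, Q)"
    and PR: "(P, R) \<in> saturation X \<alpha>" and RQ: "(R, Q) \<in> saturation X \<beta>"
    by blast
  define L where "L = Upper ` P \<union> Middle ` R \<union> Lower ` Q"
  have L: "case_sum Upper Middle u \<in> L \<longleftrightarrow> u \<in> P <+> R"
    "case_sum Middle Lower u \<in> L \<longleftrightarrow> u \<in> R <+> Q"
    "case_sum Upper Lower u \<in> L \<longleftrightarrow> u \<in> P <+> Q" for u
    by (cases u; auto simp: L_def)+
  have step: "v \<in> L" if "(u, v) \<in> product_graph \<alpha> \<beta>" "u \<in> L" for u v
  proof -
    from that(1) consider
      (left) A u' v' where "A \<in> \<alpha>" "u' \<in> A" "v' \<in> A"
        "u = case_sum Upper Middle u'" "v = case_sum Upper Middle v'"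
    | (right) B u' v' where "B \<in> \<beta>" "u' \<in> B" "v' \<in> B"
        "u = case_sum Middle Lower u'" "v = case_sum Middle Lower v'"
      unfolding product_graph_def block_graph_def by fastforce
    then show ?thesis
    proof cases
      case left
      then show ?thesis
        using \<open>u \<in> L\<close> saturation_block[OF PR left(1-3)] L(1) by simp
    next
      case right
      then show ?thesis
        using \<open>u \<in> L\<close> saturation_block[OF RQ right(1-3)] L(2) by simp
    qed
  qed
  have "v \<in> L" if "(u, v) \<in> (product_graph \<alpha> \<beta>)\<^sup>*" "u \<in> L" for u v
    using that by induction (auto intro: step)
  then have "v \<in> P <+> Q" if "(u, v) \<in> joined X \<alpha> \<beta>" "u \<in> P <+> Q" for u v
    using that unfolding joined_def by (auto simp flip: L(3))
  moreover have "P \<subseteq> X" "Q \<subseteq> X"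
    using PR RQ by (auto simp: saturation_def)
  ultimately show "PQ \<in> saturation X (diagram_mult X \<alpha> \<beta>)"
    unfolding diagram_mult_def PQ saturation_quotient[OF equiv_joined] by blast
next
  fix PQ assume "PQ \<in> saturation X (diagram_mult X \<alpha> \<beta>)"
  moreover obtain P Q where P_Q: "PQ = (P, Q)"
    by fastforce
  ultimately have "P \<subseteq> X \<and> Q \<subseteq> X \<and>
      (\<forall>(u, v)\<in>joined X \<alpha> \<beta>. u \<in> P <+> Q \<longrightarrow> v \<in> P <+> Q)"
    unfolding diagram_mult_def by (simp add: saturation_quotient[OF equiv_joined])
  then have PQ: "PQ = (P, Q)" "P \<subseteq> X" "Q \<subseteq> X"
    and "\<forall>(u, v)\<in>joined X \<alpha> \<beta>. u \<in> P <+> Q \<longrightarrow> v \<in> P <+> Q"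
    using P_Q by simp_all
  then have cl: "v \<in> P <+> Q" if "(u, v) \<in> joined X \<alpha> \<beta>" "u \<in> P <+> Q" for u v
    using that by fast
  define L where "L = (product_graph \<alpha> \<beta>)\<^sup>* `` (case_sum Upper Lower ` (P <+> Q))"
  define R where "R = {x \<in> X. Middle x \<in> L}"
  have R: "R \<subseteq> X"
    unfolding R_def by blast
  have L_step: "v \<in> L" if "u \<in> L" "(u, v) \<in> product_graph \<alpha> \<beta>" for u v
    using that unfolding L_def by (auto intro: rtrancl_into_rtrancl)
  have outer: "case_sum Upper Lower u \<in> L \<longleftrightarrow> u \<in> P <+> Q" if "u \<in> X <+> X" for u
  proof
    assume "case_sum Upper Lower u \<in> L"
    then obtain w where "w \<in> P <+> Q"
      "(case_sum Upper Lower w, case_sum Upper Lower u) \<in> (product_graph \<alpha> \<beta>)\<^sup>*"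
      unfolding L_def by blast
    moreover from this have "(w, u) \<in> joined X \<alpha> \<beta>"
      using that PQ unfolding joined_def by auto
    ultimately show "u \<in> P <+> Q" using cl by blast
  qed (auto simp: L_def)
  have Up: "Upper x \<in> L \<longleftrightarrow> x \<in> P" and Lo: "Lower x \<in> L \<longleftrightarrow> x \<in> Q" if "x \<in> X" for x
    using outer[of "Inl x"] outer[of "Inr x"] that by auto
  have L\<alpha>: "case_sum Upper Middle u \<in> L \<longleftrightarrow> u \<in> P <+> R" if "u \<in> X <+> X" for u
    using that Up by (auto simp: R_def)
  have L\<beta>: "case_sum Middle Lower u \<in> L \<longleftrightarrow> u \<in> R <+> Q" if "u \<in> X <+> X" for u
    using that Lo by (auto simp: R_def)
  have closed\<alpha>: "v \<in> P <+> R" if "A \<in> \<alpha>" "u \<in> A" "v \<in> A" "u \<in> P <+> R" for A u v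
  proof -
    have "(u, v) \<in> block_graph \<alpha>"
      using that by (auto simp: block_graph_def)
    from imageI[OF this, of "map_prod (case_sum Upper Middle) (case_sum Upper Middle)"]
    have "(case_sum Upper Middle u, case_sum Upper Middle v) \<in> product_graph \<alpha> \<beta>"
      by (simp add: product_graph_def)
    moreover have "u \<in> X <+> X" "v \<in> X <+> X"
      using partition_onD1[OF assms(1)] that(1-3) by blast+
    ultimately show ?thesis using L_step L\<alpha> that(4) by metis
  qed
  have closed\<beta>: "v \<in> R <+> Q" if "B \<in> \<beta>" "u \<in> B" "v \<in> B" "u \<in> R <+> Q" for B u v
  proof -
    have "(u, v) \<in> block_graph \<beta>"
      using that by (auto simp: block_graph_def)
    from imageI[OF this, of "map_prod (case_sum Middle Lower) (case_sum Middle Lower)"]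
    have "(case_sum Middle Lower u, case_sum Middle Lower v) \<in> product_graph \<alpha> \<beta>"
      by (simp add: product_graph_def)
    moreover have "u \<in> X <+> X" "v \<in> X <+> X"
      using partition_onD1[OF assms(2)] that(1-3) by blast+
    ultimately show ?thesis using L_step L\<beta> that(4) by metis
  qed
  have "(P, R) \<in> saturation X \<alpha>"
    by (rule saturationI[OF PQ(2) R closed\<alpha>])
  moreover have "(R, Q) \<in> saturation X \<beta>"
    by (rule saturationI[OF R PQ(3) closed\<beta>])
  ultimately show "PQ \<in> saturation X \<alpha> O saturation X \<beta>"
    unfolding PQ(1) by (rule relcompI)
qed


section \<open>Projections\<close>

text \<open>
  The diagram with blocks \<open>A \<union> A'\<close> for the classes \<open>A\<close> of \<open>\<epsilon>\<close>: the idempotent \<open>id\<^sub>\<epsilon>\<close>.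
\<close>

definition id_diagram :: "'a set \<Rightarrow> ('a \<times> 'a) set \<Rightarrow> 'a diagram" where
  "id_diagram X \<epsilon> = (\<lambda>A. A <+> A) ` (X // \<epsilon>)"

lemma partition_on_id_diagram:
  assumes "equiv X \<epsilon>"
  shows "partition_on (X <+> X) (id_diagram X \<epsilon>)"
proof -
  have p: "partition_on X (X // \<epsilon>)"
    using assms by (rule partition_on_quotient)
  show ?thesis
  proof (rule partition_onI)
    show "\<Union> (id_diagram X \<epsilon>) = X <+> X"
      using partition_onD1[OF p] by (auto simp: id_diagram_def)
    show "disjnt A B" if "A \<in> id_diagram X \<epsilon>" "B \<in> id_diagram X \<epsilon>" "A \<noteq> B" for A B
    proof -
      from that(1,2) obtain C D
        where CD: "C \<in> X // \<epsilon>" "D \<in> X // \<epsilon>" "A = C <+> C" "B = D <+> D"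
        by (auto simp: id_diagram_def)
      then have "C \<inter> D = {}"
        using \<open>A \<noteq> B\<close> disjointD[OF partition_onD2[OF p]] by blast
      then show ?thesis by (auto simp: CD disjnt_def)
    qed
    show "{} \<notin> id_diagram X \<epsilon>"
    proof
      assume "{} \<in> id_diagram X \<epsilon>"
      then obtain C where "C \<in> X // \<epsilon>" "{} = C <+> C"
        unfolding id_diagram_def by (rule imageE) simp
      then show False
        using partition_onD3[OF p] by (metis Plus_eq_empty_conv)
    qed
  qed
qed

text \<open>
  The two copies of a class lie in one block, which forces \<open>P = Q\<close>; what remains of compatibility is
  that this set is a union of classes.
\<close>

lemma saturation_id_diagram:
  assumes "equiv X \<epsilon>"
  shows "saturation X (id_diagram X \<epsilon>) = Id_on {P. P \<subseteq> X \<and> \<epsilon> `` P \<subseteq> P}"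
proof -
  have cls: "\<epsilon> `` {x} <+> \<epsilon> `` {x} \<in> id_diagram X \<epsilon>" "x \<in> \<epsilon> `` {x}" if "x \<in> X" for x
    using quotientI[OF that, of \<epsilon>] equiv_class_self[OF assms that]
    by (simp_all add: id_diagram_def)
  have "P = Q \<and> P \<subseteq> X \<and> \<epsilon> `` P \<subseteq> P" if "(P, Q) \<in> saturation X (id_diagram X \<epsilon>)" for P Q
  proof -
    have X: "P \<subseteq> X" "Q \<subseteq> X" using that by (auto simp: saturation_def)
    have eq: "u \<in> P <+> Q \<longleftrightarrow> v \<in> P <+> Q"
      if "x \<in> X" "u \<in> \<epsilon> `` {x} <+> \<epsilon> `` {x}" "v \<in> \<epsilon> `` {x} <+> \<epsilon> `` {x}" for u v x
      using saturation_block[OF \<open>(P, Q) \<in> _\<close> cls(1)[OF that(1)] that(2,3)] .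
    have "x \<in> P \<longleftrightarrow> x \<in> Q" if "x \<in> X" for x
      using eq[OF that, of "Inl x" "Inr x"] cls(2)[OF that] by auto
    moreover have "y \<in> P" if "x \<in> P" "(x, y) \<in> \<epsilon>" for x y
      using eq[of x "Inl x" "Inl y"] cls(2)[of x] that X by auto
    ultimately show ?thesis using X by auto
  qed
  moreover have "(P, P) \<in> saturation X (id_diagram X \<epsilon>)" if P: "P \<subseteq> X" "\<epsilon> `` P \<subseteq> P" for P
  proof -
    have "v \<in> P" if A: "A \<in> X // \<epsilon>" "u \<in> A" "v \<in> A" and u: "u \<in> P" for A u v
      using quotient_eq_iff[OF assms A(1) A(1) A(2,3)] u P(2) by auto
    then show ?thesis
      using P(1) by (intro saturationI) (auto simp: id_diagram_def)
  qed
  ultimately show ?thesis by auto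
qed

lemma equiv_block_graph:
  assumes "partition_on (X <+> X) \<alpha>"
  shows "equiv (X <+> X) (block_graph \<alpha>)"
proof -
  have "block_graph \<alpha> = {(u, v). \<exists>A\<in>\<alpha>. u \<in> A \<and> v \<in> A}"
    by (auto simp: block_graph_def)
  then show ?thesis using equiv_partition_on[OF assms] by simp
qed

lemma image_block_graph_in_saturation:
  assumes "partition_on (X <+> X) \<alpha>"
  shows "(Inl -` (block_graph \<alpha> `` T), Inr -` (block_graph \<alpha> `` T)) \<in> saturation X \<alpha>"
proof -
  let ?W = "block_graph \<alpha> `` T"
  have "?W \<subseteq> X <+> X"
    using equiv_type[OF equiv_block_graph[OF assms]] by blast
  then have W: "Inl -` ?W \<subseteq> X" "Inr -` ?W \<subseteq> X"
    by blast+
  have closed: "v \<in> ?W" if "A \<in> \<alpha>" "u \<in> A" "v \<in> A" "u \<in> ?W" for A u v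
  proof -
    have "(u, v) \<in> block_graph \<alpha>" using that by (auto simp: block_graph_def)
    moreover have "trans (block_graph \<alpha>)"
      using equiv_block_graph[OF assms] by (simp add: equiv_def)
    ultimately show ?thesis using that(4) by (auto dest: transD)
  qed
  show ?thesis
    by (rule saturationI[OF W]; unfold Plus_vimage_eq; rule closed)
qed

text \<open>
  With \<open>f = Inr\<close> this is the equivalence that a diagram induces on its lower row.
\<close>

lemma equiv_pullback_block_graph:
  assumes "partition_on (X <+> X) \<alpha>" "f ` X \<subseteq> X <+> X"
  shows "equiv X {(x, y). x \<in> X \<and> y \<in> X \<and> (f x, f y) \<in> block_graph \<alpha>}"
proof -
  have b: "refl_on (X <+> X) (block_graph \<alpha>)" "sym (block_graph \<alpha>)" "trans (block_graph \<alpha>)"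
    using equiv_block_graph[OF assms(1)] by (auto simp: equiv_def)
  have "(f x, f x) \<in> block_graph \<alpha>" if "x \<in> X" for x
    using assms(2) that by (blast intro: refl_onD[OF b(1)])
  then show ?thesis
    by (intro equivI refl_onI symI transI) (auto dest: symD[OF b(2)] transD[OF b(3)])
qed

text \<open>
  The second components of compatible pairs are exactly the sets saturated for the equivalence
  \<open>coker\<close> that \<open>\<alpha>\<close> induces on the lower row: a saturated \<open>Q\<close> is the lower part of the union of all
  blocks meeting it.  So the diagram of this equivalence is the required one.
\<close>

lemma ex_projection_Range:
  assumes \<alpha>: "partition_on (X <+> X) \<alpha>"
  shows "\<exists>\<epsilon>. partition_on (X <+> X) \<epsilon> \<and>
    saturation X \<epsilon> = Id_on (Range (saturation X \<alpha>))"
proof -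
  define coker where
    "coker = {(x, y). x \<in> X \<and> y \<in> X \<and> (Inr x, Inr y) \<in> block_graph \<alpha>}"
  have equiv: "equiv X coker"
    unfolding coker_def using \<alpha> by (rule equiv_pullback_block_graph) auto
  have "Q \<in> Range (saturation X \<alpha>)" if Q: "Q \<subseteq> X" "coker `` Q \<subseteq> Q" for Q
  proof -
    let ?W = "block_graph \<alpha> `` (Inr ` Q)"
    have "?W \<subseteq> X <+> X"
      using equiv_type[OF equiv_block_graph[OF \<alpha>]] by blast
    moreover have "Inr ` Q \<subseteq> ?W"
      using equiv_class_self[OF equiv_block_graph[OF \<alpha>]] Q(1) by blast
    ultimately have "Inr -` ?W = Q" using Q unfolding coker_def by blast
    then show ?thesis
      using image_block_graph_in_saturation[OF \<alpha>, of "Inr ` Q"] by (metis RangeI)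
  qed
  then have sub: "{Q. Q \<subseteq> X \<and> coker `` Q \<subseteq> Q} \<subseteq> Range (saturation X \<alpha>)"
    by (intro subsetI) simp
  have "Q \<subseteq> X \<and> coker `` Q \<subseteq> Q" if "(P, Q) \<in> saturation X \<alpha>" for P Q
  proof
    show "Q \<subseteq> X" using that by (simp add: saturation_def)
    show "coker `` Q \<subseteq> Q"
    proof
      fix y assume "y \<in> coker `` Q"
      then obtain x A where "x \<in> Q" "A \<in> \<alpha>" "Inr x \<in> A" "Inr y \<in> A"
        by (auto simp: coker_def block_graph_def)
      then show "y \<in> Q"
        using saturation_block[OF that, of A "Inr x" "Inr y"] by auto
    qed
  qed
  then have "Range (saturation X \<alpha>) \<subseteq> {Q. Q \<subseteq> X \<and> coker `` Q \<subseteq> Q}"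
    by (intro subsetI) (metis RangeE mem_Collect_eq)
  with sub have "Range (saturation X \<alpha>) = {Q. Q \<subseteq> X \<and> coker `` Q \<subseteq> Q}"
    by (simp only: subset_antisym)
  then show ?thesis
    using partition_on_id_diagram[OF equiv] saturation_id_diagram[OF equiv] by metis
qed


section \<open>Duality\<close>

text \<open>
  Turning diagrams upside down exchanges domain and codomain and replaces the saturation relation by
  its converse, which transfers results between the two rows.
\<close>

definition flip :: "'a diagram \<Rightarrow> 'a diagram" where
  "flip \<alpha> = (`) (case_sum Inr Inl) ` \<alpha>"

lemma partition_on_flip:
  assumes "partition_on (X <+> X) \<alpha>"
  shows "partition_on (X <+> X) (flip \<alpha>)"
proof -
  have "inj_on (case_sum Inr Inl) (X <+> X)"
    by (auto simp: inj_on_def split: sum.splits)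
  moreover have "case_sum Inr Inl ` (X <+> X) = X <+> X"
    by (auto simp: Plus_def image_Un image_image)
  ultimately show ?thesis
    using partition_on_inj_image[OF assms, of "case_sum Inr Inl"] partition_onD3[OF assms]
    by (simp add: flip_def image_iff)
qed

lemma saturation_flip: "saturation X (flip \<alpha>) = (saturation X \<alpha>)\<inverse>"
proof -
  have mem: "case_sum Inr Inl u \<in> P <+> Q \<longleftrightarrow> u \<in> Q <+> P" for u :: "'a + 'a" and P Q
    by (cases u) auto
  have "case_sum Inr Inl ` A \<subseteq> P <+> Q \<longleftrightarrow> A \<subseteq> Q <+> P"
    "case_sum Inr Inl ` A \<inter> (P <+> Q) = {} \<longleftrightarrow> A \<inter> (Q <+> P) = {}"
    for A :: "('a + 'a) set" and P Q
  proof -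
    have disjoint: "f ` A \<inter> B = {} \<longleftrightarrow> (\<forall>u\<in>A. f u \<notin> B)" for f :: "'a + 'a \<Rightarrow> 'a + 'a" and B
      by blast
    show "case_sum Inr Inl ` A \<inter> (P <+> Q) = {} \<longleftrightarrow> A \<inter> (Q <+> P) = {}"
      by (subst disjoint, simp only: mem) blast
    show "case_sum Inr Inl ` A \<subseteq> P <+> Q \<longleftrightarrow> A \<subseteq> Q <+> P"
      unfolding image_subset_iff mem by blast
  qed
  then show ?thesis
    by (auto simp: saturation_def flip_def)
qed

lemma diagram_codom_eq_dom_flip: "diagram_codom X \<alpha> = diagram_dom X (flip \<alpha>)"
proof -
  have "transversal (case_sum Inr Inl ` A) \<longleftrightarrow> transversal A" for A :: "('a + 'a) set"
    by (force simp: transversal_def split: sum.splits)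
  moreover have "Inl x \<in> case_sum Inr Inl ` A \<longleftrightarrow> Inr x \<in> A" for x and A :: "('a + 'a) set"
    by (force split: sum.splits)
  ultimately show ?thesis
    by (simp add: diagram_codom_def diagram_dom_def flip_def)
qed

lemma ex_projection_Domain:
  assumes "partition_on (X <+> X) \<alpha>"
  shows "\<exists>\<epsilon>. partition_on (X <+> X) \<epsilon> \<and>
    saturation X \<epsilon> = Id_on (Domain (saturation X \<alpha>))"
  using ex_projection_Range[OF partition_on_flip[OF assms]] by (simp add: saturation_flip)


section \<open>Full domain and full codomain\<close>

text \<open>
  Let \<open>(P, Q)\<close> be compatible with \<open>\<alpha>\<close>.  If \<open>\<alpha>\<close> has full domain, every upper vertex shares its block with some lower vertex, so
  that membership in \<open>P\<close> can be read off from \<open>Q\<close>.  Otherwise there is a block \<open>A\<close> inside the upper row, and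
  the empty set is paired with both \<open>A\<close> and the empty set.
\<close>

lemma full_dom_iff_single_valued:
  assumes \<alpha>: "partition_on (X <+> X) \<alpha>"
  shows "diagram_dom X \<alpha> = X \<longleftrightarrow> single_valued ((saturation X \<alpha>)\<inverse>)"
proof
  assume full: "diagram_dom X \<alpha> = X"
  have "P \<subseteq> P'" if "(P, Q) \<in> saturation X \<alpha>" "(P', Q) \<in> saturation X \<alpha>" for P P' Q
  proof
    fix x assume x: "x \<in> P"
    then have "x \<in> diagram_dom X \<alpha>" using that full by (auto simp: saturation_def)
    then obtain A a where A: "A \<in> \<alpha>" "Inl x \<in> A" "Inr a \<in> A"
      by (auto simp: diagram_dom_def transversal_def)
    then show "x \<in> P'"
      using x saturation_block[OF that(1) A] saturation_block[OF that(2) A] by auto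
  qed
  then show "single_valued ((saturation X \<alpha>)\<inverse>)"
    by (intro single_valuedI) blast
next
  assume sv: "single_valued ((saturation X \<alpha>)\<inverse>)"
  have "x \<in> diagram_dom X \<alpha>" if "x \<in> X" for x
  proof -
    obtain A where A: "A \<in> \<alpha>" "Inl x \<in> A"
      using partition_onD1[OF \<alpha>] \<open>x \<in> X\<close> by blast
    have "Inr -` A \<noteq> {}"
    proof
      assume "Inr -` A = {}"
      then have "(Inl -` A, {}) \<in> saturation X \<alpha>"
        using block_in_saturation[OF \<alpha> A(1)] by simp
      moreover have "({}, {}) \<in> saturation X \<alpha>"
        by (auto simp: saturation_def)
      ultimately have "Inl -` A = {}"
        using sv by (auto dest: single_valuedD)
      then show False using A by auto
    qed
    then have "transversal A" using A(2) by (auto simp: transversal_def)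
    then show ?thesis using A \<open>x \<in> X\<close> by (auto simp: diagram_dom_def)
  qed
  then show "diagram_dom X \<alpha> = X" by (auto simp: diagram_dom_def)
qed

corollary full_codom_iff_single_valued:
  assumes "partition_on (X <+> X) \<alpha>"
  shows "diagram_codom X \<alpha> = X \<longleftrightarrow> single_valued (saturation X \<alpha>)"
  using full_dom_iff_single_valued[OF partition_on_flip[OF assms]]
  by (simp add: diagram_codom_eq_dom_flip saturation_flip)

lemma carrier_full_domain_monoid:
  "\<alpha> \<in> carrier (full_domain_monoid X) \<longleftrightarrow>
    partition_on (X <+> X) \<alpha> \<and> single_valued ((saturation X \<alpha>)\<inverse>)"
  using full_dom_iff_single_valued[of X \<alpha>]
  by (auto simp: full_domain_monoid_def partition_monoid_def)

lemma carrier_full_codomain_monoid: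
  "\<alpha> \<in> carrier (full_codomain_monoid X) \<longleftrightarrow>
    partition_on (X <+> X) \<alpha> \<and> single_valued (saturation X \<alpha>)"
  using full_codom_iff_single_valued[of X \<alpha>]
  by (auto simp: full_codomain_monoid_def partition_monoid_def)

lemma carrier_dual_symmetric_inverse_monoid:
  "carrier (dual_symmetric_inverse_monoid X) =
    carrier (full_domain_monoid X) \<inter> carrier (full_codomain_monoid X)"
  by (auto simp: dual_symmetric_inverse_monoid_def full_domain_monoid_def
      full_codomain_monoid_def)

lemma single_valued_if_subset_Id:
  assumes "r \<subseteq> Id"
  shows "single_valued r" "single_valued (r\<inverse>)"
  using assms by (auto simp: single_valued_def)

text \<open>
  An idempotent partial injection fixes every point of its domain: if \<open>p\<close> goes to \<open>q\<close>, it does so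
  through some \<open>m\<close>, which is \<open>q\<close> by single-valuedness and \<open>p\<close> by injectivity.
\<close>

lemma subset_Id_iff:
  "r \<subseteq> Id \<longleftrightarrow> single_valued r \<and> single_valued (r\<inverse>) \<and> r O r = r"
proof
  assume "r \<subseteq> Id"
  then show "single_valued r \<and> single_valued (r\<inverse>) \<and> r O r = r"
    using single_valued_if_subset_Id[of r] by (auto simp: relcomp_unfold subset_iff)
next
  assume "single_valued r \<and> single_valued (r\<inverse>) \<and> r O r = r"
  then have r: "single_valued r" "single_valued (r\<inverse>)" "r O r = r"
    by simp_all
  have "p = q" if "(p, q) \<in> r" for p q
  proof -
    from that have "(p, q) \<in> r O r"
      by (simp only: r(3))
    then obtain m where m: "(p, m) \<in> r" "(m, q) \<in> r"
      by (rule relcompE) simp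
    have "m = q"
      using single_valuedD[OF r(1) m(1) that] .
    moreover have "m = p"
      using single_valuedD[OF r(2), of q m p] m(2) that by simp
    ultimately show ?thesis by simp
  qed
  then show "r \<subseteq> Id" by auto
qed

text \<open>
  Members of the dual symmetric inverse monoid are the diagrams represented by partial injections,
  and idempotency of a diagram is, by faithfulness, idempotency of its relation.
\<close>

lemma idempotents_dual_symmetric_inverse_monoid:
  "idempotents (dual_symmetric_inverse_monoid X) =
    {\<epsilon>. partition_on (X <+> X) \<epsilon> \<and> saturation X \<epsilon> \<subseteq> Id}"
proof -
  have mult: "\<epsilon> \<otimes>\<^bsub>dual_symmetric_inverse_monoid X\<^esub> \<epsilon> = diagram_mult X \<epsilon> \<epsilon>" for \<epsilon>
    by (simp add: dual_symmetric_inverse_monoid_def partition_monoid_def)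
  have idem: "diagram_mult X \<epsilon> \<epsilon> = \<epsilon> \<longleftrightarrow> saturation X \<epsilon> O saturation X \<epsilon> = saturation X \<epsilon>"
    if "partition_on (X <+> X) \<epsilon>" for \<epsilon>
    using that saturation_mult[OF that that] partition_on_diagram_mult
    by (metis (mono_tags) inj_onD mem_Collect_eq saturation_inj)
  show ?thesis
    unfolding idempotents_def carrier_dual_symmetric_inverse_monoid mult
  proof (rule Collect_cong)
    show "\<epsilon> \<in> carrier (full_domain_monoid X) \<inter> carrier (full_codomain_monoid X) \<and>
        diagram_mult X \<epsilon> \<epsilon> = \<epsilon> \<longleftrightarrow> partition_on (X <+> X) \<epsilon> \<and> saturation X \<epsilon> \<subseteq> Id" for \<epsilon>
      unfolding subset_Id_iff Int_iff carrier_full_domain_monoid carrier_full_codomain_monoid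
      using idem by blast
  qed
qed


section \<open>The monoids\<close>

lemma one_eq_id_diagram: "\<one>\<^bsub>partition_monoid X\<^esub> = id_diagram X (Id_on X)"
proof -
  have "X // Id_on X = (\<lambda>x. {x}) ` X"
    by (auto simp: quotient_def)
  moreover have "{x} <+> {x} = {Inl x, Inr x}" for x :: 'a
    by auto
  ultimately show ?thesis
    by (simp add: id_diagram_def partition_monoid_def image_image)
qed

lemma equiv_Id_on: "equiv X (Id_on X)"
  by (intro equivI refl_onI symI transI) auto

lemma partition_on_one: "partition_on (X <+> X) \<one>\<^bsub>partition_monoid X\<^esub>"
  by (simp add: one_eq_id_diagram partition_on_id_diagram equiv_Id_on)

lemma saturation_one: "saturation X \<one>\<^bsub>partition_monoid X\<^esub> = Id_on (Pow X)"
proof -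
  have "{P. P \<subseteq> X \<and> Id_on X `` P \<subseteq> P} = Pow X"
    by auto
  then show ?thesis
    by (simp add: one_eq_id_diagram saturation_id_diagram equiv_Id_on)
qed

text \<open>
  All monoid laws are pulled back from relations along the faithful representation; in particular,
  no path in a graph with four rows of vertices has to be analysed.
\<close>

lemma monoid_partition_monoid: "monoid (partition_monoid X)"
proof -
  have eq: "\<alpha> = \<beta>" if "partition_on (X <+> X) \<alpha>" "partition_on (X <+> X) \<beta>"
    "saturation X \<alpha> = saturation X \<beta>" for \<alpha> \<beta>
    using that saturation_inj by (auto dest: inj_onD)
  have Pow: "saturation X \<alpha> \<subseteq> Pow X \<times> Pow X" for \<alpha>
    by (auto simp: saturation_def)
  have mult: "\<alpha> \<otimes>\<^bsub>partition_monoid X\<^esub> \<beta> = diagram_mult X \<alpha> \<beta>" for \<alpha> \<beta>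
    by (simp add: partition_monoid_def)
  have carrier: "\<alpha> \<in> carrier (partition_monoid X) \<longleftrightarrow> partition_on (X <+> X) \<alpha>" for \<alpha>
    by (simp add: partition_monoid_def)
  show ?thesis
  proof (rule monoidI; unfold mult carrier)
    show "partition_on (X <+> X) (diagram_mult X \<alpha> \<beta>)" for \<alpha> \<beta>
      by (rule partition_on_diagram_mult)
    show "partition_on (X <+> X) \<one>\<^bsub>partition_monoid X\<^esub>"
      by (rule partition_on_one)
    show "diagram_mult X (diagram_mult X \<alpha> \<beta>) \<gamma> = diagram_mult X \<alpha> (diagram_mult X \<beta> \<gamma>)"
      if "partition_on (X <+> X) \<alpha>" "partition_on (X <+> X) \<beta>" "partition_on (X <+> X) \<gamma>"
      for \<alpha> \<beta> \<gamma>
      using that by (intro eq) (simp_all add: saturation_mult partition_on_diagram_mult O_assoc)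
    show "diagram_mult X \<one>\<^bsub>partition_monoid X\<^esub> \<alpha> = \<alpha>" if "partition_on (X <+> X) \<alpha>" for \<alpha>
    proof (rule eq)
      show "saturation X (diagram_mult X \<one>\<^bsub>partition_monoid X\<^esub> \<alpha>) = saturation X \<alpha>"
        unfolding saturation_mult[OF partition_on_one that] saturation_one using Pow[of \<alpha>] by blast
    qed (use that in \<open>simp_all add: partition_on_diagram_mult\<close>)
    show "diagram_mult X \<alpha> \<one>\<^bsub>partition_monoid X\<^esub> = \<alpha>" if "partition_on (X <+> X) \<alpha>" for \<alpha>
    proof (rule eq)
      show "saturation X (diagram_mult X \<alpha> \<one>\<^bsub>partition_monoid X\<^esub>) = saturation X \<alpha>"
        unfolding saturation_mult[OF that partition_on_one] saturation_one using Pow[of \<alpha>] by blast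
    qed (use that in \<open>simp_all add: partition_on_diagram_mult\<close>)
  qed
qed

lemma mult_full_domain_monoid [simp]:
  "\<alpha> \<otimes>\<^bsub>full_domain_monoid X\<^esub> \<beta> = diagram_mult X \<alpha> \<beta>"
  by (simp add: full_domain_monoid_def partition_monoid_def)

lemma mult_full_codomain_monoid [simp]:
  "\<alpha> \<otimes>\<^bsub>full_codomain_monoid X\<^esub> \<beta> = diagram_mult X \<alpha> \<beta>"
  by (simp add: full_codomain_monoid_def partition_monoid_def)

lemma full_domain_mult_closed:
  assumes "\<alpha> \<in> carrier (full_domain_monoid X)" "\<beta> \<in> carrier (full_domain_monoid X)"
  shows "diagram_mult X \<alpha> \<beta> \<in> carrier (full_domain_monoid X)"
  using assms
  by (simp add: carrier_full_domain_monoid partition_on_diagram_mult saturation_mult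
      converse_relcomp single_valued_relcomp)

lemma full_codomain_mult_closed:
  assumes "\<alpha> \<in> carrier (full_codomain_monoid X)" "\<beta> \<in> carrier (full_codomain_monoid X)"
  shows "diagram_mult X \<alpha> \<beta> \<in> carrier (full_codomain_monoid X)"
  using assms
  by (simp add: carrier_full_codomain_monoid partition_on_diagram_mult saturation_mult
      single_valued_relcomp)

lemma monoid_full_domain_monoid: "monoid (full_domain_monoid X)"
proof -
  have submonoid: "submonoid (carrier (full_domain_monoid X)) (partition_monoid X)"
  proof
    show "\<one>\<^bsub>partition_monoid X\<^esub> \<in> carrier (full_domain_monoid X)"
      by (simp add: carrier_full_domain_monoid partition_on_one saturation_one single_valued_Id_on)
    show "\<alpha> \<otimes>\<^bsub>partition_monoid X\<^esub> \<beta> \<in> carrier (full_domain_monoid X)"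
      if "\<alpha> \<in> carrier (full_domain_monoid X)" "\<beta> \<in> carrier (full_domain_monoid X)" for \<alpha> \<beta>
      using full_domain_mult_closed[OF that] by (simp add: partition_monoid_def)
  qed (auto simp: full_domain_monoid_def)
  have "full_domain_monoid X = (partition_monoid X)\<lparr>carrier := carrier (full_domain_monoid X)\<rparr>"
    by (simp add: full_domain_monoid_def)
  then show ?thesis
    using submonoid.submonoid_is_monoid[OF submonoid monoid_partition_monoid] by simp
qed

lemma monoid_full_codomain_monoid: "monoid (full_codomain_monoid X)"
proof -
  have submonoid: "submonoid (carrier (full_codomain_monoid X)) (partition_monoid X)"
  proof
    show "\<one>\<^bsub>partition_monoid X\<^esub> \<in> carrier (full_codomain_monoid X)"
      by (simp add: carrier_full_codomain_monoid partition_on_one saturation_one single_valued_Id_on)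
    show "\<alpha> \<otimes>\<^bsub>partition_monoid X\<^esub> \<beta> \<in> carrier (full_codomain_monoid X)"
      if "\<alpha> \<in> carrier (full_codomain_monoid X)" "\<beta> \<in> carrier (full_codomain_monoid X)" for \<alpha> \<beta>
      using full_codomain_mult_closed[OF that] by (simp add: partition_monoid_def)
  qed (auto simp: full_codomain_monoid_def)
  have "full_codomain_monoid X = (partition_monoid X)\<lparr>carrier := carrier (full_codomain_monoid X)\<rparr>"
    by (simp add: full_codomain_monoid_def)
  then show ?thesis
    using submonoid.submonoid_is_monoid[OF submonoid monoid_partition_monoid] by simp
qed

lemma right_restriction_full_domain_monoid:
  "right_restriction (full_domain_monoid X) (idempotents (dual_symmetric_inverse_monoid X))"
proof -
  have "right_restriction (full_domain_monoid X)
    {\<epsilon> \<in> carrier (full_domain_monoid X). saturation X \<epsilon> \<subseteq> Id}"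
  proof (rule right_restriction_if_relational_representation)
    show "inj_on (saturation X) (carrier (full_domain_monoid X))"
      using saturation_inj by (rule inj_on_subset) (auto simp: carrier_full_domain_monoid)
    show "\<exists>\<epsilon>\<in>carrier (full_domain_monoid X). saturation X \<epsilon> = Id_on (Range (saturation X \<alpha>))"
      if "\<alpha> \<in> carrier (full_domain_monoid X)" for \<alpha>
      using that ex_projection_Range[of X \<alpha>] unfolding carrier_full_domain_monoid
      by (metis carrier_full_domain_monoid converse_Id_on single_valued_Id_on)
  qed (simp_all add: carrier_full_domain_monoid saturation_mult partition_on_diagram_mult
      converse_relcomp single_valued_relcomp)
  moreover have "{\<epsilon> \<in> carrier (full_domain_monoid X). saturation X \<epsilon> \<subseteq> Id} =
    idempotents (dual_symmetric_inverse_monoid X)"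
    using single_valued_if_subset_Id
    by (auto simp: idempotents_dual_symmetric_inverse_monoid carrier_full_domain_monoid)
  ultimately show ?thesis by simp
qed

lemma left_restriction_full_codomain_monoid:
  "left_restriction (full_codomain_monoid X) (idempotents (dual_symmetric_inverse_monoid X))"
proof -
  have "left_restriction (full_codomain_monoid X)
    {\<epsilon> \<in> carrier (full_codomain_monoid X). saturation X \<epsilon> \<subseteq> Id}"
  proof (rule left_restriction_if_relational_representation)
    show "inj_on (saturation X) (carrier (full_codomain_monoid X))"
      using saturation_inj by (rule inj_on_subset) (auto simp: carrier_full_codomain_monoid)
    show "\<exists>\<epsilon>\<in>carrier (full_codomain_monoid X). saturation X \<epsilon> = Id_on (Domain (saturation X \<alpha>))"
      if "\<alpha> \<in> carrier (full_codomain_monoid X)" for \<alpha>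
      using that ex_projection_Domain[of X \<alpha>] unfolding carrier_full_codomain_monoid
      by (metis carrier_full_codomain_monoid single_valued_Id_on)
  qed (simp_all add: carrier_full_codomain_monoid saturation_mult partition_on_diagram_mult
      single_valued_relcomp)
  moreover have "{\<epsilon> \<in> carrier (full_codomain_monoid X). saturation X \<epsilon> \<subseteq> Id} =
    idempotents (dual_symmetric_inverse_monoid X)"
    using single_valued_if_subset_Id
    by (auto simp: idempotents_dual_symmetric_inverse_monoid carrier_full_codomain_monoid)
  ultimately show ?thesis by simp
qed

theorem proposition4p23:
  fixes X :: "'a set"
  defines "F \<equiv> idempotents (dual_symmetric_inverse_monoid X)"
  shows "monoid (full_domain_monoid X) \<and> right_restriction (full_domain_monoid X) F \<and>
    monoid (full_codomain_monoid X) \<and> left_restriction (full_codomain_monoid X) F \<and>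
    carrier (full_domain_monoid X) \<inter> carrier (full_codomain_monoid X)
      = carrier (dual_symmetric_inverse_monoid X)"
  unfolding F_def
  using monoid_full_domain_monoid right_restriction_full_domain_monoid
    monoid_full_codomain_monoid left_restriction_full_codomain_monoid
    carrier_dual_symmetric_inverse_monoid by blast

end
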